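(* Let $A$ be a propositional variable and let $K,B$ be integer parameters. With the robustness criteria defined in the context (those taking integer parameters all being taken with the same parameters $K,B$), all of the following implications are valid, where $X\to Y$ means $\models_{dc}X\Rightarrow Y$: - $AssumeFalse(A)\to BeCorrect(A)$; - $BeCorrect(A)\to ResCnt(A,K,B)$; - $BeCorrect(A)\to BeCurrentlyCorrect(A)$; - $ResCnt(A,K,B)\to LenCnt(A,K,B)$; - $ResCnt(A,K,B)\to ResCntInt(A,K,B)$; - $LenCnt(A,K,B)\to ResBurst(A,K,B)$ and $LenCnt(A,K,B)\to LenBurst(A,K,B)$; - $ResBurst(A,K,B)\to LenBurst(A,K,B)$ and $LenBurst(A,K,B)\to ResBurst(A,K,B)$; - $LenCnt(A,K,B)\to LenCntInt(A,K,B)$; - $ResCntInt(A,K,B)\to ResBurstInt(A,K,B)$; - $ResCntInt(A,K,B)\to LenCntInt(A,K,B)$; - $ResBurst(A,K,B)\to ResBurstInt(A,K,B)$ and $LenBurst(A,K,B)\to ResBurstInt(A,K,B)$; - $ResBurstInt(A,K,B)\to LenBurstInt(A,K,B)$; - $LenCntInt(A,K,B)\to LenBurstInt(A,K,B)$; - $LenBurstInt(A,K,B)\to AssumeTrue(A)$; - $BeCurrentlyCorrect(A)\to AssumeTrue(A)$.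
   Context: **QDDC (the fragment used).** Let $PV$ be a finite set of propositional variables containing $A$, and $\sigma=P_0\cdots P_n$ a non-empty finite word over $2^{PV}$. For a propositional formula $\varphi$, $\sigma,i\models\varphi$ means that $\varphi$ is true under the valuation making exactly the variables in $P_i$ true. For an interval $[b,e]$ with $0\le b\le e\le n$: $\sigma,[b,e]\models\langle\varphi\rangle$ iff $b=e$ and $\sigma,b\models\varphi$; $\sigma,[b,e]\models[[\varphi]]$ iff $\sigma,i\models\varphi$ for all $b\le i\le e$; $\sigma,[b,e]\models D_1{}^\frown D_2$ iff there is $i$ with $b\le i\le e$, $\sigma,[b,i]\models D_1$ and $\sigma,[i,e]\models D_2$; Boolean connectives $!,\&\&,||,\Rightarrow$ as usual; $true$ holds on every interval and $false$ on none. The term $slen$ has value $e-b$, and $scount\ \varphi$ is the number of $i$ with $b\le i\le e$ and $\sigma,i\models\varphi$; in the syntax of QDDC these terms are compared (by $<,\le,=,\ge,>$) with constants $c\in\mathbb N$. Derived: $\langle\rangle D=true{}^\frown D{}^\frown true$ (some subinterval satisfies $D$); $[]D=\ !\langle\rangle !D$ (all subintervals satisfy $D$). A formula $D$ is valid, $\models_{dc}D$, iff $\sigma,[0,n]\models D$ for every non-empty word $\sigma=P_0\cdots P_n$. **Error-type formulas.** - $LocalErr(A)=true{}^\frown\langle !A\rangle$; - $CountErr(A,k)=(scount\ !A>k)$; - $BurstErr(A,k)=([[!A]]\ \&\&\ slen\ge k)$; - $HasBurstErr(A,k)=\langle\rangle BurstErr(A,k)$; - $HasNoRecovery(A,b)=[]([[A]]\Rightarrow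 slen<b-1)$; - $RecoveryErr(b,Err)=(Err\ \&\&\ HasNoRecovery(A,b))$. **Error-scope formulas.** - $NeverInPast(Err)=\ !\langle\rangle Err$; - $NeverInSuffix(Err)=\ !(true{}^\frown Err)$; - $NeverInPastLen(b,Err)=\ !\langle\rangle(slen\le b-1\ \&\&\ Err)$; - $NeverInSuffixLen(b,Err)=\ !(true{}^\frown(slen\le b-1\ \&\&\ Err))$. **Robustness criteria.** - $AssumeFalse(A)=false$; - $BeCorrect(A)=NeverInPast(LocalErr(A))$; - $BeCurrentlyCorrect(A)=NeverInSuffix(LocalErr(A))$; - $ResCnt(A,K,B)=NeverInPast(RecoveryErr(B,CountErr(A,K)))$; - $ResCntInt(A,K,B)=NeverInSuffix(RecoveryErr(B,CountErr(A,K)))$; - $ResBurst(A,K,B)=NeverInPast(RecoveryErr(B,HasBurstErr(A,K)))$; - $ResBurstInt(A,K,B)=NeverInSuffix(RecoveryErr(B,HasBurstErr(A,K)))$; - $LenCnt(A,K,B)=NeverInPastLen(B,CountErr(A,K))$; - $LenCntInt(A,K,B)=NeverInSuffixLen(B,CountErr(A,K))$; - $LenBurst(A,K,B)=NeverInPastLen(B,HasBurstErr(A,K))$; - $LenBurstInt(A,K,B)=NeverInSuffixLen(B,HasBurstErr(A,K))$; - $AssumeTrue(A)=true$.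
   Formalization: K is taken ≥ 0 (QDDC constants are naturals), and LenCnt→ResBurst, LenBurst→ResBurst, LenBurst→ResBurstInt are claimed only for K<B: if B≤K, a word of K+1 letters without A satisfies LenCnt and LenBurst but neither ResBurst nor ResBurstInt. *)

theory Defs
  imports Main
begin

datatype 'v pform =
    PVar 'v
  | PTrue
  | PFalse
  | PNot "'v pform"
  | PAnd "'v pform" "'v pform"
  | POr "'v pform" "'v pform"
  | PImp "'v pform" "'v pform"

primrec ptrue :: "'v set \<Rightarrow> 'v pform \<Rightarrow> bool" where
  "ptrue P (PVar v) \<longleftrightarrow> v \<in> P"
| "ptrue P PTrue \<longleftrightarrow> True"
| "ptrue P PFalse \<longleftrightarrow> False"
| "ptrue P (PNot p) \<longleftrightarrow> \<not> ptrue P p"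
| "ptrue P (PAnd p q) \<longleftrightarrow> ptrue P p \<and> ptrue P q"
| "ptrue P (POr p q) \<longleftrightarrow> ptrue P p \<or> ptrue P q"
| "ptrue P (PImp p q) \<longleftrightarrow> (ptrue P p \<longrightarrow> ptrue P q)"

datatype cmp = Lt | Le | Eq | Ge | Gt

primrec cmp_rel :: "cmp \<Rightarrow> int \<Rightarrow> int \<Rightarrow> bool" where
  "cmp_rel Lt x y \<longleftrightarrow> x < y"
| "cmp_rel Le x y \<longleftrightarrow> x \<le> y"
| "cmp_rel Eq x y \<longleftrightarrow> x = y"
| "cmp_rel Ge x y \<longleftrightarrow> x \<ge> y"
| "cmp_rel Gt x y \<longleftrightarrow> x > y"

text \<open>
  QDDC compares \<open>slen\<close> and \<open>scount\<close> with natural constants only. Integer constants are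
  allowed here so that the bound \<open>b - 1\<close> in the formulas below is genuine, not truncated,
  subtraction; formulas with natural constants keep their meaning.
\<close>

datatype 'v qddc =
    QTrue
  | QFalse
  | QPoint "'v pform"
  | QInv "'v pform"
  | QChop "'v qddc" "'v qddc"  (infixr \<open>\<frown>\<close> 75)
  | QNot "'v qddc"
  | QAnd "'v qddc" "'v qddc"
  | QOr "'v qddc" "'v qddc"
  | QImp "'v qddc" "'v qddc"  (infixr \<open>\<rightarrow>\<^sub>D\<close> 60)
  | QSlen cmp int
  | QScount "'v pform" cmp int

text \<open>
  A word is the list of its letters; \<open>sat \<sigma> b e D\<close> is meaningful for
  \<open>b \<le> e\<close> and \<open>e < length \<sigma>\<close>.
\<close>

primrec sat :: "'v set list \<Rightarrow> nat \<Rightarrow> nat \<Rightarrow> 'v qddc \<Rightarrow> bool" where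
  "sat \<sigma> b e QTrue \<longleftrightarrow> True"
| "sat \<sigma> b e QFalse \<longleftrightarrow> False"
| "sat \<sigma> b e (QPoint p) \<longleftrightarrow> b = e \<and> ptrue (\<sigma> ! b) p"
| "sat \<sigma> b e (QInv p) \<longleftrightarrow> (\<forall>i. b \<le> i \<and> i \<le> e \<longrightarrow> ptrue (\<sigma> ! i) p)"
| "sat \<sigma> b e (D1 \<frown> D2) \<longleftrightarrow> (\<exists>i. b \<le> i \<and> i \<le> e \<and> sat \<sigma> b i D1 \<and> sat \<sigma> i e D2)"
| "sat \<sigma> b e (QNot D) \<longleftrightarrow> \<not> sat \<sigma> b e D"
| "sat \<sigma> b e (QAnd D1 D2) \<longleftrightarrow> sat \<sigma> b e D1 \<and> sat \<sigma> b e D2"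
| "sat \<sigma> b e (QOr D1 D2) \<longleftrightarrow> sat \<sigma> b e D1 \<or> sat \<sigma> b e D2"
| "sat \<sigma> b e (D1 \<rightarrow>\<^sub>D D2) \<longleftrightarrow> (sat \<sigma> b e D1 \<longrightarrow> sat \<sigma> b e D2)"
| "sat \<sigma> b e (QSlen r c) \<longleftrightarrow> cmp_rel r (int e - int b) c"
| "sat \<sigma> b e (QScount p r c) \<longleftrightarrow>
     cmp_rel r (int (card {i. b \<le> i \<and> i \<le> e \<and> ptrue (\<sigma> ! i) p})) c"

definition QDia :: "'v qddc \<Rightarrow> 'v qddc" where
  "QDia D = QTrue \<frown> D \<frown> QTrue"

definition QBox :: "'v qddc \<Rightarrow> 'v qddc" where
  "QBox D = QNot (QDia (QNot D))"

definition dc_valid :: "'v set \<Rightarrow> 'v qddc \<Rightarrow> bool" where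
  "dc_valid PV D \<longleftrightarrow>
     (\<forall>\<sigma>. \<sigma> \<noteq> [] \<and> set \<sigma> \<subseteq> Pow PV \<longrightarrow> sat \<sigma> 0 (length \<sigma> - 1) D)"

definition LocalErr :: "'v \<Rightarrow> 'v qddc" where
  "LocalErr A = QTrue \<frown> QPoint (PNot (PVar A))"

definition CountErr :: "'v \<Rightarrow> int \<Rightarrow> 'v qddc" where
  "CountErr A k = QScount (PNot (PVar A)) Gt k"

definition BurstErr :: "'v \<Rightarrow> int \<Rightarrow> 'v qddc" where
  "BurstErr A k = QAnd (QInv (PNot (PVar A))) (QSlen Ge k)"

definition HasBurstErr :: "'v \<Rightarrow> int \<Rightarrow> 'v qddc" where
  "HasBurstErr A k = QDia (BurstErr A k)"

definition HasNoRecovery :: "'v \<Rightarrow> int \<Rightarrow> 'v qddc" where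
  "HasNoRecovery A b = QBox (QInv (PVar A) \<rightarrow>\<^sub>D QSlen Lt (b - 1))"

definition RecoveryErr :: "'v \<Rightarrow> int \<Rightarrow> 'v qddc \<Rightarrow> 'v qddc" where
  "RecoveryErr A b Err = QAnd Err (HasNoRecovery A b)"

definition NeverInPast :: "'v qddc \<Rightarrow> 'v qddc" where
  "NeverInPast Err = QNot (QDia Err)"

definition NeverInSuffix :: "'v qddc \<Rightarrow> 'v qddc" where
  "NeverInSuffix Err = QNot (QTrue \<frown> Err)"

definition NeverInPastLen :: "int \<Rightarrow> 'v qddc \<Rightarrow> 'v qddc" where
  "NeverInPastLen b Err = QNot (QDia (QAnd (QSlen Le (b - 1)) Err))"

definition NeverInSuffixLen :: "int \<Rightarrow> 'v qddc \<Rightarrow> 'v qddc" where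
  "NeverInSuffixLen b Err = QNot (QTrue \<frown> QAnd (QSlen Le (b - 1)) Err)"

definition AssumeFalse :: "'v \<Rightarrow> 'v qddc" where
  "AssumeFalse A = QFalse"

definition BeCorrect :: "'v \<Rightarrow> 'v qddc" where
  "BeCorrect A = NeverInPast (LocalErr A)"

definition BeCurrentlyCorrect :: "'v \<Rightarrow> 'v qddc" where
  "BeCurrentlyCorrect A = NeverInSuffix (LocalErr A)"

definition ResCnt :: "'v \<Rightarrow> int \<Rightarrow> int \<Rightarrow> 'v qddc" where
  "ResCnt A K B = NeverInPast (RecoveryErr A B (CountErr A K))"

definition ResCntInt :: "'v \<Rightarrow> int \<Rightarrow> int \<Rightarrow> 'v qddc" where
  "ResCntInt A K B = NeverInSuffix (RecoveryErr A B (CountErr A K))"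

definition ResBurst :: "'v \<Rightarrow> int \<Rightarrow> int \<Rightarrow> 'v qddc" where
  "ResBurst A K B = NeverInPast (RecoveryErr A B (HasBurstErr A K))"

definition ResBurstInt :: "'v \<Rightarrow> int \<Rightarrow> int \<Rightarrow> 'v qddc" where
  "ResBurstInt A K B = NeverInSuffix (RecoveryErr A B (HasBurstErr A K))"

definition LenCnt :: "'v \<Rightarrow> int \<Rightarrow> int \<Rightarrow> 'v qddc" where
  "LenCnt A K B = NeverInPastLen B (CountErr A K)"

definition LenCntInt :: "'v \<Rightarrow> int \<Rightarrow> int \<Rightarrow> 'v qddc" where
  "LenCntInt A K B = NeverInSuffixLen B (CountErr A K)"

definition LenBurst :: "'v \<Rightarrow> int \<Rightarrow> int \<Rightarrow> 'v qddc" where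
  "LenBurst A K B = NeverInPastLen B (HasBurstErr A K)"

definition LenBurstInt :: "'v \<Rightarrow> int \<Rightarrow> int \<Rightarrow> 'v qddc" where
  "LenBurstInt A K B = NeverInSuffixLen B (HasBurstErr A K)"

definition AssumeTrue :: "'v \<Rightarrow> 'v qddc" where
  "AssumeTrue A = QTrue"

end

theory Submission
  imports Defs
begin

text \<open>
  Every criterion forbids an error on all subintervals, or on all suffixes, of the current
  interval. Two facts link the recovery and the length scopes. An interval with
  \<open>slen \<le> B - 1\<close> containing a point outside \<open>A\<close> has no \<open>A\<close>-run of length \<open>B - 1\<close>, so it
  satisfies \<open>HasNoRecovery\<close>. Conversely, a burst contains a burst of length exactly \<open>K\<close>,
  which fits into \<open>slen \<le> B - 1\<close> when \<open>K < B\<close>. Count and burst errors are compared by counting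
  the \<open>K + 1\<close> points of such a burst.
\<close>

lemma dc_valid_impI:
  assumes "\<And>\<sigma> e. sat \<sigma> 0 e D1 \<Longrightarrow> sat \<sigma> 0 e D2"
  shows "dc_valid PV (D1 \<rightarrow>\<^sub>D D2)"
  using assms by (simp add: dc_valid_def)

lemma sat_QDia:
  "sat \<sigma> b e (QDia D) \<longleftrightarrow> (\<exists>i j. b \<le> i \<and> i \<le> j \<and> j \<le> e \<and> sat \<sigma> i j D)"
  unfolding QDia_def by (auto intro: order_trans)

lemma sat_NeverInPast:
  "sat \<sigma> b e (NeverInPast D) \<longleftrightarrow> (\<forall>i j. b \<le> i \<and> i \<le> j \<and> j \<le> e \<longrightarrow> \<not> sat \<sigma> i j D)"
  by (auto simp: NeverInPast_def sat_QDia)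

lemma sat_NeverInSuffix:
  "sat \<sigma> b e (NeverInSuffix D) \<longleftrightarrow> (\<forall>i. b \<le> i \<and> i \<le> e \<longrightarrow> \<not> sat \<sigma> i e D)"
  by (auto simp: NeverInSuffix_def)

text \<open>Absorbing the length bound into the error lets the rules for the plain scopes serve the
  length scopes as well.\<close>

lemma NeverInPastLen_eq: "NeverInPastLen B D = NeverInPast (QAnd (QSlen Le (B - 1)) D)"
  by (simp add: NeverInPastLen_def NeverInPast_def)

lemma NeverInSuffixLen_eq: "NeverInSuffixLen B D = NeverInSuffix (QAnd (QSlen Le (B - 1)) D)"
  by (simp add: NeverInSuffixLen_def NeverInSuffix_def)

lemma NeverInPast_imp_NeverInSuffix:
  "sat \<sigma> b e (NeverInPast D) \<Longrightarrow> sat \<sigma> b e (NeverInSuffix D)"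
  by (simp add: sat_NeverInPast sat_NeverInSuffix)

lemma NeverInSuffix_mono:
  assumes "sat \<sigma> b e (NeverInSuffix D)"
    and "\<And>i. i \<le> e \<Longrightarrow> sat \<sigma> i e D' \<Longrightarrow> sat \<sigma> i e D"
  shows "sat \<sigma> b e (NeverInSuffix D')"
  using assms unfolding sat_NeverInSuffix by blast

text \<open>Subintervals of subintervals are subintervals, so it is enough that \<open>D'\<close>
  contains \<open>D\<close> somewhere inside. For \<open>NeverInSuffix\<close> the inner interval
  may miss the right end, so the rule there keeps the interval fixed.\<close>

lemma NeverInPast_reduce:
  assumes "sat \<sigma> b e (NeverInPast D)"
    and "\<And>i j. i \<le> j \<Longrightarrow> sat \<sigma> i j D' \<Longrightarrow> sat \<sigma> i j (QDia D)"
  shows "sat \<sigma> b e (NeverInPast D')"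
  using assms unfolding sat_NeverInPast sat_QDia by (meson order_trans)

lemma sat_imp_QDia: "b \<le> e \<Longrightarrow> sat \<sigma> b e D \<Longrightarrow> sat \<sigma> b e (QDia D)"
  unfolding sat_QDia by blast

lemma NeverInPast_mono:
  assumes "sat \<sigma> b e (NeverInPast D)"
    and "\<And>i j. i \<le> j \<Longrightarrow> sat \<sigma> i j D' \<Longrightarrow> sat \<sigma> i j D"
  shows "sat \<sigma> b e (NeverInPast D')"
  using assms(1) by (rule NeverInPast_reduce) (blast intro: sat_imp_QDia assms(2))

lemma sat_HasBurstErr:
  "sat \<sigma> b e (HasBurstErr A K) \<longleftrightarrow>
     (\<exists>i j. b \<le> i \<and> i \<le> j \<and> j \<le> e \<and> K \<le> int j - int i \<and> (\<forall>l. i \<le> l \<and> l \<le> j \<longrightarrow> A \<notin> \<sigma> ! l))"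
  unfolding HasBurstErr_def BurstErr_def sat_QDia by (simp add: conj_ac)

lemma HasBurstErr_imp_CountErr:
  assumes "sat \<sigma> b e (HasBurstErr A K)"
  shows "sat \<sigma> b e (CountErr A K)"
proof -
  obtain i j where ij: "b \<le> i" "i \<le> j" "j \<le> e" "K \<le> int j - int i" "\<forall>l. i \<le> l \<and> l \<le> j \<longrightarrow> A \<notin> \<sigma> ! l"
    using assms unfolding sat_HasBurstErr by blast
  \<comment> \<open>\<open>slen\<close> counts steps and \<open>scount\<close> counts points:
    \<open>{i..j}\<close> has \<open>j - i + 1\<close> elements, which exceeds
    \<open>K\<close>.\<close>
  have "card {i..j} \<le> card {l. b \<le> l \<and> l \<le> e \<and> A \<notin> \<sigma> ! l}"
    by (rule card_mono) (use ij in auto)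
  with ij show ?thesis
    by (simp add: CountErr_def)
qed

text \<open>With \<open>0 \<le> K\<close> a count above \<open>K\<close> is positive; for negative
  \<open>K\<close> an interval without errors would satisfy \<open>CountErr\<close>.\<close>

lemma CountErr_imp_LocalErr:
  assumes "0 \<le> K" and "sat \<sigma> b e (CountErr A K)"
  shows "sat \<sigma> b e (QDia (LocalErr A))"
proof -
  have "0 < card {i. b \<le> i \<and> i \<le> e \<and> A \<notin> \<sigma> ! i}"
    using assms by (simp add: CountErr_def)
  then obtain i where "b \<le> i" "i \<le> e" "A \<notin> \<sigma> ! i"
    by (auto simp: card_gt_0_iff)
  then show ?thesis
    by (auto simp: sat_QDia LocalErr_def)
qed

text \<open>Any sign of \<open>K\<close> is allowed here: even a burst with \<open>slen\<close> 0
  contains a point outside \<open>A\<close>.\<close>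

lemma HasBurstErr_imp_LocalErr:
  assumes "sat \<sigma> b e (HasBurstErr A K)"
  shows "sat \<sigma> b e (QDia (LocalErr A))"
  using assms by (fastforce simp: sat_HasBurstErr sat_QDia LocalErr_def)

lemma short_LocalErr_imp_HasNoRecovery:
  assumes "sat \<sigma> b e (QSlen Le (B - 1))" and "sat \<sigma> b e (QDia (LocalErr A))"
  shows "sat \<sigma> b e (HasNoRecovery A B)"
proof -
  obtain l where l: "b \<le> l" "l \<le> e" "A \<notin> \<sigma> ! l"
    using assms(2) by (auto simp: sat_QDia LocalErr_def intro: order_trans)
  have "int j - int i < B - 1"
    if "b \<le> i" "i \<le> j" "j \<le> e" "\<forall>m. i \<le> m \<and> m \<le> j \<longrightarrow> A \<in> \<sigma> ! m" for i j
  proof -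
    \<comment> \<open>The \<open>A\<close>-run lies strictly to one side of \<open>l\<close>, which
      costs at least one step and turns \<open>\<le> B - 1\<close> into
      \<open>< B - 1\<close>.\<close>
    have "l < i \<or> j < l"
      using that(4) l(3) not_le by blast
    with that(1,3) l assms(1) show ?thesis
      by auto
  qed
  then show ?thesis
    by (auto simp: HasNoRecovery_def QBox_def sat_QDia)
qed

lemma short_CountErr_imp_RecoveryErr:
  assumes "0 \<le> K" and "sat \<sigma> b e (QAnd (QSlen Le (B - 1)) (CountErr A K))"
  shows "sat \<sigma> b e (RecoveryErr A B (CountErr A K))"
  using assms CountErr_imp_LocalErr short_LocalErr_imp_HasNoRecovery
  unfolding RecoveryErr_def by fastforce

lemma short_HasBurstErr_imp_RecoveryErr:
  assumes "sat \<sigma> b e (QAnd (QSlen Le (B - 1)) (HasBurstErr A K))"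
  shows "sat \<sigma> b e (RecoveryErr A B (HasBurstErr A K))"
  using assms HasBurstErr_imp_LocalErr short_LocalErr_imp_HasNoRecovery
  unfolding RecoveryErr_def by fastforce

lemma HasBurstErr_imp_short_HasBurstErr:
  assumes "0 \<le> K" "K < B" and "sat \<sigma> b e (HasBurstErr A K)"
  shows "sat \<sigma> b e (QDia (QAnd (QSlen Le (B - 1)) (HasBurstErr A K)))"
proof -
  obtain i j where ij: "b \<le> i" "i \<le> j" "j \<le> e" "K \<le> int j - int i" "\<forall>l. i \<le> l \<and> l \<le> j \<longrightarrow> A \<notin> \<sigma> ! l"
    using assms(3) unfolding sat_HasBurstErr by blast
  \<comment> \<open>Cut the burst after exactly \<open>K\<close> steps; \<open>nat K\<close> loses
    nothing since \<open>0 \<le> K\<close>, and \<open>K < B\<close> makes the cut interval short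
    enough.\<close>
  define k where "k = i + nat K"
  have k: "i \<le> k" "k \<le> j" "int k - int i = K"
    using ij assms(1) by (auto simp: k_def)
  have "sat \<sigma> i k (HasBurstErr A K)"
    unfolding sat_HasBurstErr by (rule exI[of _ i], rule exI[of _ k]) (use k ij(5) in auto)
  with k assms(2) have "sat \<sigma> i k (QAnd (QSlen Le (B - 1)) (HasBurstErr A K))"
    by simp
  with ij(1,3) k(1,2) show ?thesis
    unfolding sat_QDia by (meson order_trans)
qed

lemma BeCorrect_imp_ResCnt:
  assumes "0 \<le> K" and "sat \<sigma> b e (BeCorrect A)"
  shows "sat \<sigma> b e (ResCnt A K B)"
  using assms(2) unfolding BeCorrect_def ResCnt_def
  by (rule NeverInPast_reduce)
     (auto simp: RecoveryErr_def intro: CountErr_imp_LocalErr[OF assms(1)])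

lemma ResCnt_imp_LenCnt:
  assumes "0 \<le> K" and "sat \<sigma> b e (ResCnt A K B)"
  shows "sat \<sigma> b e (LenCnt A K B)"
  using assms(2) unfolding ResCnt_def LenCnt_def NeverInPastLen_eq
  by (rule NeverInPast_mono) (rule short_CountErr_imp_RecoveryErr[OF assms(1)])

lemma LenCnt_imp_LenBurst:
  assumes "sat \<sigma> b e (LenCnt A K B)"
  shows "sat \<sigma> b e (LenBurst A K B)"
  using assms unfolding LenCnt_def LenBurst_def NeverInPastLen_eq
  by (rule NeverInPast_mono) (simp add: HasBurstErr_imp_CountErr)

lemma ResBurst_imp_LenBurst:
  assumes "sat \<sigma> b e (ResBurst A K B)"
  shows "sat \<sigma> b e (LenBurst A K B)"
  using assms unfolding ResBurst_def LenBurst_def NeverInPastLen_eq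
  by (rule NeverInPast_mono) (rule short_HasBurstErr_imp_RecoveryErr)

text \<open>The short burst lies on a possibly smaller interval, hence
  \<open>NeverInPast_reduce\<close> instead of \<open>NeverInPast_mono\<close>.\<close>

lemma LenBurst_imp_ResBurst:
  assumes "0 \<le> K" "K < B" and "sat \<sigma> b e (LenBurst A K B)"
  shows "sat \<sigma> b e (ResBurst A K B)"
  using assms(3) unfolding ResBurst_def LenBurst_def NeverInPastLen_eq
  by (rule NeverInPast_reduce)
     (rule HasBurstErr_imp_short_HasBurstErr[OF assms(1,2)], simp add: RecoveryErr_def)

lemma ResCntInt_imp_ResBurstInt:
  assumes "sat \<sigma> b e (ResCntInt A K B)"
  shows "sat \<sigma> b e (ResBurstInt A K B)"
  using assms unfolding ResCntInt_def ResBurstInt_def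
  by (rule NeverInSuffix_mono) (simp add: RecoveryErr_def HasBurstErr_imp_CountErr)

lemma ResCntInt_imp_LenCntInt:
  assumes "0 \<le> K" and "sat \<sigma> b e (ResCntInt A K B)"
  shows "sat \<sigma> b e (LenCntInt A K B)"
  using assms(2) unfolding ResCntInt_def LenCntInt_def NeverInSuffixLen_eq
  by (rule NeverInSuffix_mono) (rule short_CountErr_imp_RecoveryErr[OF assms(1)])

lemma ResBurstInt_imp_LenBurstInt:
  assumes "sat \<sigma> b e (ResBurstInt A K B)"
  shows "sat \<sigma> b e (LenBurstInt A K B)"
  using assms unfolding ResBurstInt_def LenBurstInt_def NeverInSuffixLen_eq
  by (rule NeverInSuffix_mono) (rule short_HasBurstErr_imp_RecoveryErr)

lemma LenCntInt_imp_LenBurstInt: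
  assumes "sat \<sigma> b e (LenCntInt A K B)"
  shows "sat \<sigma> b e (LenBurstInt A K B)"
  using assms unfolding LenCntInt_def LenBurstInt_def NeverInSuffixLen_eq
  by (rule NeverInSuffix_mono) (simp add: HasBurstErr_imp_CountErr)

lemma BeCorrect_imp_BeCurrentlyCorrect:
  "sat \<sigma> b e (BeCorrect A) \<Longrightarrow> sat \<sigma> b e (BeCurrentlyCorrect A)"
  unfolding BeCorrect_def BeCurrentlyCorrect_def by (rule NeverInPast_imp_NeverInSuffix)

lemma ResCnt_imp_ResCntInt: "sat \<sigma> b e (ResCnt A K B) \<Longrightarrow> sat \<sigma> b e (ResCntInt A K B)"
  unfolding ResCnt_def ResCntInt_def by (rule NeverInPast_imp_NeverInSuffix)

lemma LenCnt_imp_LenCntInt: "sat \<sigma> b e (LenCnt A K B) \<Longrightarrow> sat \<sigma> b e (LenCntInt A K B)"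
  unfolding LenCnt_def LenCntInt_def NeverInPastLen_eq NeverInSuffixLen_eq
  by (rule NeverInPast_imp_NeverInSuffix)

lemma ResBurst_imp_ResBurstInt: "sat \<sigma> b e (ResBurst A K B) \<Longrightarrow> sat \<sigma> b e (ResBurstInt A K B)"
  unfolding ResBurst_def ResBurstInt_def by (rule NeverInPast_imp_NeverInSuffix)

(* 0 \<le> K because K occurs as a constant in the formulas. The implications guarded by
   K < B are not valid for 0 \<le> K and B \<le> K: a word of K + 1 letters, none of them containing
   A, satisfies LenCnt and LenBurst but neither ResBurst nor ResBurstInt. *)
theorem theorem3:
  fixes PV :: "'v set" and A :: 'v and K B :: int
  assumes "finite PV" and "A \<in> PV" and "0 \<le> K"
  shows
    "dc_valid PV (AssumeFalse A \<rightarrow>\<^sub>D BeCorrect A) \<and>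
     dc_valid PV (BeCorrect A \<rightarrow>\<^sub>D ResCnt A K B) \<and>
     dc_valid PV (BeCorrect A \<rightarrow>\<^sub>D BeCurrentlyCorrect A) \<and>
     dc_valid PV (ResCnt A K B \<rightarrow>\<^sub>D LenCnt A K B) \<and>
     dc_valid PV (ResCnt A K B \<rightarrow>\<^sub>D ResCntInt A K B) \<and>
     (K < B \<longrightarrow> dc_valid PV (LenCnt A K B \<rightarrow>\<^sub>D ResBurst A K B)) \<and>
     dc_valid PV (LenCnt A K B \<rightarrow>\<^sub>D LenBurst A K B) \<and>
     dc_valid PV (ResBurst A K B \<rightarrow>\<^sub>D LenBurst A K B) \<and>
     (K < B \<longrightarrow> dc_valid PV (LenBurst A K B \<rightarrow>\<^sub>D ResBurst A K B)) \<and>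
     dc_valid PV (LenCnt A K B \<rightarrow>\<^sub>D LenCntInt A K B) \<and>
     dc_valid PV (ResCntInt A K B \<rightarrow>\<^sub>D ResBurstInt A K B) \<and>
     dc_valid PV (ResCntInt A K B \<rightarrow>\<^sub>D LenCntInt A K B) \<and>
     dc_valid PV (ResBurst A K B \<rightarrow>\<^sub>D ResBurstInt A K B) \<and>
     (K < B \<longrightarrow> dc_valid PV (LenBurst A K B \<rightarrow>\<^sub>D ResBurstInt A K B)) \<and>
     dc_valid PV (ResBurstInt A K B \<rightarrow>\<^sub>D LenBurstInt A K B) \<and>
     dc_valid PV (LenCntInt A K B \<rightarrow>\<^sub>D LenBurstInt A K B) \<and>
     dc_valid PV (LenBurstInt A K B \<rightarrow>\<^sub>D AssumeTrue A) \<and>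
     dc_valid PV (BeCurrentlyCorrect A \<rightarrow>\<^sub>D AssumeTrue A)"
  by (intro conjI impI dc_valid_impI)
     \<comment> \<open>Two arrows are compositions: \<open>LenCnt\<close> reaches
       \<open>ResBurst\<close> through \<open>LenBurst\<close>, and \<open>LenBurst\<close> reaches
       \<open>ResBurstInt\<close> through \<open>ResBurst\<close>.\<close>
     (simp_all add: AssumeFalse_def AssumeTrue_def assms(3) BeCorrect_imp_ResCnt
        BeCorrect_imp_BeCurrentlyCorrect ResCnt_imp_LenCnt ResCnt_imp_ResCntInt
        LenCnt_imp_LenBurst LenBurst_imp_ResBurst ResBurst_imp_LenBurst LenCnt_imp_LenCntInt
        ResCntInt_imp_ResBurstInt ResCntInt_imp_LenCntInt ResBurst_imp_ResBurstInt
        ResBurstInt_imp_LenBurstInt LenCntInt_imp_LenBurstInt)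

end
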